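(* The height function $H:L_2\to\mathbb Z$ and its negation $-H$, which are points of the horofunction boundary $\partial_h L_2$ of the lamplighter group $L_2$ with the word metric for $\{t,at\}$, are global fixed points of the action of $L_2$ on $\partial_h L_2$.
   Context: Lamplighter group: $L_2=\langle a,t\mid a^2,\ [a^{t^i},a^{t^j}]\ \forall i,j\in\mathbb Z\rangle\cong(\bigoplus_{\mathbb Z}\mathbb Z/2)\rtimes\mathbb Z$. Each element is identified with a lamp stand: a finite set of lit lamps (positions in $\mathbb Z$) together with an integer position of the lamplighter. The identity $id$ has no lit lamps and lamplighter at $0$; right multiplication by $a$ toggles the lamp at the lamplighter's position; right multiplication by $t$ moves the lamplighter by $+1$. $H(g)$ is the lamplighter's position in $g$ (equivalently the exponent sum of $t$). $d$ is the word metric on $L_2$ with respect to $S=\{t,at\}$, i.e. $d(g,h)$ is the length of $g^{-1}h$ in $S\cup S^{-1}$. Horofunction boundary: $C(L_2)$ is the space of functions $L_2\to\mathbb R$ with the topology of uniform convergence on finite sets; $i(z)(x)=d(z,x)-d(z,id)$ embeds $L_2$ in $C(L_2)$; $\overline{L_2}$ is the closure of $i(L_2)$ and $\partial_h L_2=\overline{L_2}\setminus i(L_2)$. For a sequence $(y_n)$ in $L_2$, $h_{y_n}(x)=\lim_{n\to\infty}\big(d(y_n,x)-d(y_n,id)\big)$ when this limit exists for all $x$. Action: $L_2$ acts on itself by left multiplication, and this extends to $\overline{L_2}$ and $\partial_h L_2$ by $g\cdot h_{y_n}=h_{g y_n}$, i.e. $(g\cdot h_{y_n})(x)=\lim_n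 \big(d(gy_n,x)-d(gy_n,id)\big)$. *)

theory Defs
  imports
    "HOL-Analysis.Function_Topology"
    "HOL-Algebra.Generated_Groups"
    "HOL-Library.FSet"
begin

section \<open>The lamplighter group\<close>

text \<open>A lamp stand is the finite set of positions of its lit lamps together with the
  position of the lamplighter.\<close>

type_synonym lamp_stand = "int fset \<times> int"

definition fsym_diff :: "int fset \<Rightarrow> int fset \<Rightarrow> int fset" where
  "fsym_diff A B = (A |-| B) |\<union>| (B |-| A)"

definition fshift :: "int \<Rightarrow> int fset \<Rightarrow> int fset" where
  "fshift m B = (\<lambda>i. m + i) |`| B"

text \<open>This is the semidirect product of the finitely supported configurations of lamps (with
  symmetric difference as addition) by the integers acting by translation. Every element of the
  type represents a group element, so the carrier is the whole type.\<close>

definition lamplighter :: "lamp_stand monoid" where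
  "lamplighter =
    \<lparr>carrier = UNIV,
     mult = (\<lambda>(A, m) (B, n). (fsym_diff A (fshift m B), m + n)),
     one = ({||}, 0)\<rparr>"

definition gen_a :: lamp_stand where
  "gen_a = ({|0|}, 0)"

definition gen_t :: lamp_stand where
  "gen_t = ({||}, 1)"

definition height :: "lamp_stand \<Rightarrow> int" where
  "height = snd"

section \<open>The word metric\<close>

text \<open>If \<open>g\<close> is not a product of generators and their inverses, the value is meaningless; the
  lemma \<open>lamplighter_words\<close> below excludes this for the generating set used here.\<close>

definition word_length :: "('a, 'b) monoid_scheme \<Rightarrow> 'a set \<Rightarrow> 'a \<Rightarrow> nat" where
  "word_length G S g =
    (LEAST n. \<exists>ws. set ws \<subseteq> S \<union> (\<lambda>s. inv\<^bsub>G\<^esub> s) ` S \<and> length ws = n \<and>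
                   foldr (mult G) ws \<one>\<^bsub>G\<^esub> = g)"

definition lamp_gens :: "lamp_stand set" where
  "lamp_gens = {gen_t, gen_a \<otimes>\<^bsub>lamplighter\<^esub> gen_t}"

definition lamp_dist :: "lamp_stand \<Rightarrow> lamp_stand \<Rightarrow> nat" where
  "lamp_dist g h =
    word_length lamplighter lamp_gens (inv\<^bsub>lamplighter\<^esub> g \<otimes>\<^bsub>lamplighter\<^esub> h)"

section \<open>The horofunction boundary\<close>

definition horo :: "lamp_stand \<Rightarrow> lamp_stand \<Rightarrow> real" where
  "horo z x = real (lamp_dist z x) - real (lamp_dist z \<one>\<^bsub>lamplighter\<^esub>)"

text \<open>The closure refers to the library's topology on functions, the product topology. It is the
  topology of uniform convergence on finite sets, see \<open>open_fun_iff_finite_uniform\<close> below.\<close>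

definition horo_closure :: "(lamp_stand \<Rightarrow> real) set" where
  "horo_closure = closure (range horo)"

definition horo_boundary :: "(lamp_stand \<Rightarrow> real) set" where
  "horo_boundary = horo_closure - range horo"

text \<open>\<open>has_horolim y h\<close> says that \<open>h\<close> is the function \<open>h\<^sub>y\<close> of the sequence \<open>y\<close>, and in particular
  that the limit defining it exists at every point.\<close>

definition has_horolim :: "(nat \<Rightarrow> lamp_stand) \<Rightarrow> (lamp_stand \<Rightarrow> real) \<Rightarrow> bool" where
  "has_horolim y h \<longleftrightarrow>
    (\<forall>x. (\<lambda>n. real (lamp_dist (y n) x) - real (lamp_dist (y n) \<one>\<^bsub>lamplighter\<^esub>)) \<longlonglongrightarrow> h x)"

text \<open>The action sends \<open>h\<^sub>y\<close> to \<open>h\<close> of the translated sequence. That the result exists and does not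
  depend on the choice of \<open>y\<close> is \<open>ex_has_horolim\<close> together with \<open>horo_act_eqI\<close> and
  \<open>has_horolim_translate\<close> below; the boundary is invariant by \<open>horo_act_boundary\<close>.\<close>

definition horo_act :: "lamp_stand \<Rightarrow> (lamp_stand \<Rightarrow> real) \<Rightarrow> lamp_stand \<Rightarrow> real" where
  "horo_act g h =
    (THE k. \<exists>y. has_horolim y h \<and> has_horolim (\<lambda>n. g \<otimes>\<^bsub>lamplighter\<^esub> y n) k)"

section \<open>Well-definedness\<close>

lemma carrier_lamplighter [simp]: "carrier lamplighter = UNIV"
  by (simp add: lamplighter_def)

lemma one_lamplighter: "\<one>\<^bsub>lamplighter\<^esub> = ({||}, 0)"
  by (simp add: lamplighter_def)

lemma mult_lamplighter:
  "(A, m) \<otimes>\<^bsub>lamplighter\<^esub> (B, n) = (fsym_diff A (fshift m B), m + n)"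
  by (simp add: lamplighter_def)

lemma in_fsym_diff [simp]: "x |\<in>| fsym_diff A B \<longleftrightarrow> (x |\<in>| A) \<noteq> (x |\<in>| B)"
  by (auto simp: fsym_diff_def)

lemma in_fshift [simp]: "x |\<in>| fshift m B \<longleftrightarrow> x - m |\<in>| B"
  by (force simp: fshift_def image_iff)

lemma group_lamplighter: "group lamplighter"
proof (rule groupI)
  fix x y z
  show "x \<otimes>\<^bsub>lamplighter\<^esub> y \<otimes>\<^bsub>lamplighter\<^esub> z = x \<otimes>\<^bsub>lamplighter\<^esub> (y \<otimes>\<^bsub>lamplighter\<^esub> z)"
    by (cases x; cases y; cases z)
       (auto simp: mult_lamplighter diff_diff_eq intro!: fset_eqI)
next
  fix x
  show "\<one>\<^bsub>lamplighter\<^esub> \<otimes>\<^bsub>lamplighter\<^esub> x = x"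
    by (cases x) (auto simp: one_lamplighter mult_lamplighter intro!: fset_eqI)
next
  fix x
  have "(fshift (- snd x) (fst x), - snd x) \<otimes>\<^bsub>lamplighter\<^esub> x = \<one>\<^bsub>lamplighter\<^esub>"
    by (cases x) (auto simp: one_lamplighter mult_lamplighter intro!: fset_eqI)
  then show "\<exists>y\<in>carrier lamplighter. y \<otimes>\<^bsub>lamplighter\<^esub> x = \<one>\<^bsub>lamplighter\<^esub>"
    by (metis UNIV_I carrier_lamplighter)
qed auto

interpretation L2: group lamplighter
  by (rule group_lamplighter)

lemma mult_gen_a: "(A, m) \<otimes>\<^bsub>lamplighter\<^esub> gen_a = (fsym_diff A {|m|}, m)"
  by (auto simp: mult_lamplighter gen_a_def intro!: fset_eqI)

lemma mult_gen_t: "(A, m) \<otimes>\<^bsub>lamplighter\<^esub> gen_t = (A, m + 1)"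
  by (auto simp: mult_lamplighter gen_t_def intro!: fset_eqI)

lemma generate_lamp_gens: "generate lamplighter lamp_gens = UNIV"
proof -
  let ?K = "generate lamplighter lamp_gens"
  have K: "subgroup ?K lamplighter"
    by (rule L2.generate_is_subgroup) simp
  have t: "gen_t \<in> ?K" and at: "gen_a \<otimes>\<^bsub>lamplighter\<^esub> gen_t \<in> ?K"
    by (auto intro: generate.incl simp: lamp_gens_def)
  have ti: "inv\<^bsub>lamplighter\<^esub> gen_t \<in> ?K"
    using K t by (simp add: subgroup.m_inv_closed)
  have "gen_a = (gen_a \<otimes>\<^bsub>lamplighter\<^esub> gen_t) \<otimes>\<^bsub>lamplighter\<^esub> inv\<^bsub>lamplighter\<^esub> gen_t"
    by (simp add: L2.m_assoc)
  then have a: "gen_a \<in> ?K"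
    by (metis K at subgroup.m_closed ti)
  have ti_eq: "inv\<^bsub>lamplighter\<^esub> gen_t = ({||}, - 1)"
    by (rule L2.inv_equality) (auto simp: gen_t_def mult_lamplighter one_lamplighter intro!: fset_eqI)
  have move: "(A, m) \<in> ?K" if "(A, 0) \<in> ?K" for A m
  proof (induction m rule: int_induct[where k = 0])
    case base
    then show ?case using that .
  next
    case (step1 i)
    then show ?case
      using subgroup.m_closed[OF K _ t] by (metis mult_gen_t)
  next
    case (step2 i)
    have "(A, i) \<otimes>\<^bsub>lamplighter\<^esub> ({||}, - 1) = (A, i - 1)"
      by (auto simp: mult_lamplighter intro!: fset_eqI)
    then show ?case
      using subgroup.m_closed[OF K step2(2) ti] by (simp add: ti_eq)
  qed
  have return: "(A, 0) \<in> ?K" if "(A, m) \<in> ?K" for A m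
  proof -
    have "({||}, - m) \<in> ?K"
      using move[of "{||}" "- m"] K by (metis one_lamplighter subgroup.one_closed)
    moreover have "(A, m) \<otimes>\<^bsub>lamplighter\<^esub> ({||}, - m) = (A, 0)"
      by (auto simp: mult_lamplighter intro!: fset_eqI)
    ultimately show ?thesis
      using that by (metis K subgroup.m_closed)
  qed
  have "(A, 0) \<in> ?K" for A
  proof (induction A rule: fset_induct_stronger)
    case empty
    then show ?case using K by (metis one_lamplighter subgroup.one_closed)
  next
    case (insert x A)
    have "(A, x) \<otimes>\<^bsub>lamplighter\<^esub> gen_a \<in> ?K"
      using subgroup.m_closed[OF K move[OF insert.IH] a] .
    moreover have "fsym_diff A {|x|} = finsert x A"
      using insert by (auto intro!: fset_eqI)
    ultimately show ?case
      using return by (simp add: mult_gen_a)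
  qed
  then show ?thesis
    using move by auto
qed

lemma lamplighter_words:
  "\<exists>ws. set ws \<subseteq> lamp_gens \<union> (\<lambda>s. inv\<^bsub>lamplighter\<^esub> s) ` lamp_gens \<and>
        foldr (mult lamplighter) ws \<one>\<^bsub>lamplighter\<^esub> = g"
    (is "\<exists>ws. ?P g ws")
proof -
  have app: "foldr (mult lamplighter) (us @ vs) \<one>\<^bsub>lamplighter\<^esub> =
      foldr (mult lamplighter) us \<one>\<^bsub>lamplighter\<^esub> \<otimes>\<^bsub>lamplighter\<^esub>
      foldr (mult lamplighter) vs \<one>\<^bsub>lamplighter\<^esub>" for us vs
    by (induction us) (simp_all add: L2.m_assoc)
  have "g \<in> generate lamplighter lamp_gens"
    by (simp add: generate_lamp_gens)
  then show ?thesis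
  proof (induction rule: generate.induct)
    case one
    have "?P \<one>\<^bsub>lamplighter\<^esub> []" by simp
    then show ?case ..
  next
    case (incl h)
    then have "?P h [h]" by simp
    then show ?case ..
  next
    case (inv h)
    then have "?P (inv\<^bsub>lamplighter\<^esub> h) [inv\<^bsub>lamplighter\<^esub> h]" by simp
    then show ?case ..
  next
    case (eng h1 h2)
    then obtain us vs where "?P h1 us" "?P h2 vs" by blast
    then have "?P (h1 \<otimes>\<^bsub>lamplighter\<^esub> h2) (us @ vs)" by (simp add: app del: foldr_append)
    then show ?case ..
  qed
qed

lemma open_fun_iff_finite_uniform:
  fixes U :: "('a \<Rightarrow> real) set"
  shows "open U \<longleftrightarrow>
    (\<forall>f\<in>U. \<exists>F e. finite F \<and> e > 0 \<and> {g. \<forall>x\<in>F. \<bar>g x - f x\<bar> < e} \<subseteq> U)"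
proof
  assume U: "open U"
  show "\<forall>f\<in>U. \<exists>F e. finite F \<and> e > 0 \<and> {g. \<forall>x\<in>F. \<bar>g x - f x\<bar> < e} \<subseteq> U"
  proof
    fix f assume "f \<in> U"
    then obtain X where X: "f \<in> (\<Pi>\<^sub>E i\<in>UNIV. X i)" "\<And>i. open (X i)"
        "finite {i. X i \<noteq> UNIV}" "(\<Pi>\<^sub>E i\<in>UNIV. X i) \<subseteq> U"
      using product_topology_open_contains_basis[of "\<lambda>_. euclidean" UNIV U f] U
      by (auto simp: open_fun_def)
    define F where "F = {i. X i \<noteq> UNIV}"
    have "\<forall>i. \<exists>e>0. \<forall>r. \<bar>r - f i\<bar> < e \<longrightarrow> r \<in> X i"
      using X(1,2) by (auto simp: open_dist dist_real_def PiE_iff)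
    then obtain e where e: "\<And>i. e i > 0" "\<And>i r. \<bar>r - f i\<bar> < e i \<Longrightarrow> r \<in> X i"
      by metis
    define d where "d = Min (insert 1 (e ` F))"
    have fin: "finite (insert 1 (e ` F))"
      using X(3) by (simp add: F_def)
    have d: "d > 0" "\<And>i. i \<in> F \<Longrightarrow> d \<le> e i"
      using fin e(1) by (auto simp: d_def)
    have "{g. \<forall>x\<in>F. \<bar>g x - f x\<bar> < d} \<subseteq> (\<Pi>\<^sub>E i\<in>UNIV. X i)"
    proof (clarsimp simp: PiE_iff)
      fix g i assume g: "\<forall>x\<in>F. \<bar>g x - f x\<bar> < d"
      show "g i \<in> X i"
      proof (cases "i \<in> F")
        case True
        then show ?thesis using g d(2) e(2) by (meson less_le_trans)
      next
        case False
        then show ?thesis by (auto simp: F_def)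
      qed
    qed
    then show "\<exists>F e. finite F \<and> e > 0 \<and> {g. \<forall>x\<in>F. \<bar>g x - f x\<bar> < e} \<subseteq> U"
      using X(3,4) d(1)
      by (intro exI[of _ F] exI[of _ d]) (simp add: F_def)
  qed
next
  assume *: "\<forall>f\<in>U. \<exists>F e. finite F \<and> e > 0 \<and> {g. \<forall>x\<in>F. \<bar>g x - f x\<bar> < e} \<subseteq> U"
  show "open U"
  proof (subst open_subopen, intro ballI)
    fix f assume "f \<in> U"
    then obtain F and e :: real where F: "finite F" "e > 0"
        "{g. \<forall>x\<in>F. \<bar>g x - f x\<bar> < e} \<subseteq> U"
      using * by blast
    have "{g. \<forall>x\<in>F. \<bar>g x - f x\<bar> < e} = (\<Inter>x\<in>F. {g. \<bar>g x - f x\<bar> < e})"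
      by auto
    moreover have "open {g :: 'a \<Rightarrow> real. \<bar>g x - f x\<bar> < e}" for x
      by (intro open_Collect_less continuous_intros continuous_on_product_coordinates)
    ultimately have "open {g. \<forall>x\<in>F. \<bar>g x - f x\<bar> < e}"
      using F(1) by (simp add: open_INT)
    then show "\<exists>T. open T \<and> f \<in> T \<and> T \<subseteq> U"
      using F by (intro exI[of _ "{g. \<forall>x\<in>F. \<bar>g x - f x\<bar> < e}"]) auto
  qed
qed

lemma has_horolim_iff: "has_horolim y h \<longleftrightarrow> (\<forall>x. (\<lambda>n. horo (y n) x) \<longlonglongrightarrow> h x)"
  by (simp add: has_horolim_def horo_def)

lemma ex_has_horolim:
  assumes "h \<in> horo_closure"
  shows "\<exists>y. has_horolim y h"
proof -
  obtain s where s: "\<forall>n. s n \<in> range horo" "s \<longlonglongrightarrow> h"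
    using assms unfolding horo_closure_def closure_sequential by blast
  from s(1) have "\<forall>n. \<exists>z. s n = horo z"
    by blast
  from choice[OF this] obtain y where "\<forall>n. s n = horo (y n)" ..
  then have "s = (\<lambda>n. horo (y n))"
    by (intro ext) simp
  with s(2) have "(\<lambda>n. horo (y n)) \<longlonglongrightarrow> h"
    by simp
  then have "(\<lambda>n. horo (y n) x) \<longlonglongrightarrow> h x" for x
    by (rule continuous_on_tendsto_compose
        [where f = "\<lambda>f. f x" and s = UNIV, OF continuous_on_product_coordinates]) simp_all
  then show ?thesis
    unfolding has_horolim_iff by blast
qed

lemma lamp_dist_translate:
  "lamp_dist (g \<otimes>\<^bsub>lamplighter\<^esub> y) x = lamp_dist y (inv\<^bsub>lamplighter\<^esub> g \<otimes>\<^bsub>lamplighter\<^esub> x)"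
  by (simp add: lamp_dist_def L2.inv_mult_group L2.m_assoc)

lemma has_horolim_translate:
  assumes "has_horolim y h"
  shows "has_horolim (\<lambda>n. g \<otimes>\<^bsub>lamplighter\<^esub> y n)
           (\<lambda>x. h (inv\<^bsub>lamplighter\<^esub> g \<otimes>\<^bsub>lamplighter\<^esub> x) - h (inv\<^bsub>lamplighter\<^esub> g))"
  unfolding has_horolim_iff
proof
  fix x
  let ?i = "inv\<^bsub>lamplighter\<^esub> g"
  have "(\<lambda>n. horo (y n) (?i \<otimes>\<^bsub>lamplighter\<^esub> x) - horo (y n) ?i)
      \<longlonglongrightarrow> h (?i \<otimes>\<^bsub>lamplighter\<^esub> x) - h ?i"
    using assms unfolding has_horolim_iff by (intro tendsto_diff) blast+
  then show "(\<lambda>n. horo (g \<otimes>\<^bsub>lamplighter\<^esub> y n) x) \<longlonglongrightarrow> h (?i \<otimes>\<^bsub>lamplighter\<^esub> x) - h ?i"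
    by (simp add: horo_def lamp_dist_translate)
qed

lemma has_horolim_unique: "has_horolim y h \<Longrightarrow> has_horolim y k \<Longrightarrow> h = k"
  unfolding has_horolim_def by (meson LIMSEQ_unique ext)

lemma horo_act_eqI:
  assumes "has_horolim y h" "has_horolim (\<lambda>n. g \<otimes>\<^bsub>lamplighter\<^esub> y n) k"
  shows "horo_act g h = k"
  unfolding horo_act_def
proof (rule the_equality)
  show "\<exists>y. has_horolim y h \<and> has_horolim (\<lambda>n. g \<otimes>\<^bsub>lamplighter\<^esub> y n) k"
    using assms by blast
  show "l = k" if "\<exists>y. has_horolim y h \<and> has_horolim (\<lambda>n. g \<otimes>\<^bsub>lamplighter\<^esub> y n) l" for l
    using that assms has_horolim_translate has_horolim_unique by metis
qed

lemma horo_act_boundary: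
  assumes "h \<in> horo_boundary"
  shows "horo_act g h \<in> horo_boundary"
proof -
  let ?i = "inv\<^bsub>lamplighter\<^esub> g"
  obtain y where y: "has_horolim y h"
    using assms ex_has_horolim by (auto simp: horo_boundary_def)
  define k where "k = (\<lambda>x. h (?i \<otimes>\<^bsub>lamplighter\<^esub> x) - h ?i)"
  have k: "has_horolim (\<lambda>n. g \<otimes>\<^bsub>lamplighter\<^esub> y n) k"
    using has_horolim_translate[OF y] by (simp add: k_def)
  have "k \<in> horo_closure"
    unfolding horo_closure_def closure_sequential
  proof (intro exI conjI allI)
    show "horo (g \<otimes>\<^bsub>lamplighter\<^esub> y n) \<in> range horo" for n
      by blast
    show "(\<lambda>n. horo (g \<otimes>\<^bsub>lamplighter\<^esub> y n)) \<longlonglongrightarrow> k"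
    proof (rule topological_tendstoI)
      fix U assume "open U" "k \<in> U"
      then obtain F and e :: real where F: "finite F" "e > 0"
          "{f. \<forall>x\<in>F. \<bar>f x - k x\<bar> < e} \<subseteq> U"
        unfolding open_fun_iff_finite_uniform by blast
      have "\<forall>x\<in>F. \<forall>\<^sub>F n in sequentially. \<bar>horo (g \<otimes>\<^bsub>lamplighter\<^esub> y n) x - k x\<bar> < e"
        using k F(2) unfolding has_horolim_iff tendsto_iff dist_real_def by blast
      then have "\<forall>\<^sub>F n in sequentially. \<forall>x\<in>F. \<bar>horo (g \<otimes>\<^bsub>lamplighter\<^esub> y n) x - k x\<bar> < e"
        by (rule eventually_ball_finite[OF F(1)])
      then show "\<forall>\<^sub>F n in sequentially. horo (g \<otimes>\<^bsub>lamplighter\<^esub> y n) \<in> U"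
        by (rule eventually_mono) (use F(3) in blast)
    qed
  qed
  moreover have "k \<notin> range horo"
  proof
    assume "k \<in> range horo"
    then obtain z where z: "k = horo z" ..
    have "(\<lambda>n. horo (y n) \<one>\<^bsub>lamplighter\<^esub>) \<longlonglongrightarrow> h \<one>\<^bsub>lamplighter\<^esub>"
      using y unfolding has_horolim_iff by (rule spec)
    then have "h \<one>\<^bsub>lamplighter\<^esub> = 0"
      by (simp add: horo_def LIMSEQ_const_iff)
    have "h x = k (g \<otimes>\<^bsub>lamplighter\<^esub> x) - k g" for x
      using \<open>h \<one>\<^bsub>lamplighter\<^esub> = 0\<close> by (simp add: k_def flip: L2.m_assoc)
    then have "h x = horo (?i \<otimes>\<^bsub>lamplighter\<^esub> z) x" for x
      by (simp add: z horo_def lamp_dist_translate)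
    then have "h = horo (?i \<otimes>\<^bsub>lamplighter\<^esub> z)"
      by (rule ext)
    then have "h \<in> range horo"
      by (rule range_eqI)
    then show False
      using assms by (simp add: horo_boundary_def)
  qed
  ultimately show ?thesis
    using horo_act_eqI[OF y k] by (simp add: horo_boundary_def)
qed

end

theory Submission
  imports Defs
begin

text \<open>Right multiplication by a letter moves the lamplighter across one edge \<open>{i, i + 1}\<close> of the
  line, with the option of toggling the lamp \<open>i\<close>. So a word for \<open>(C, m)\<close> is a walk from \<open>0\<close> to \<open>m\<close>
  that crosses the edge of every lamp in \<open>C\<close>. The walk from \<open>({|-n|}, n)\<close> to \<open>x\<close> has to cross the edge
  of the lamp \<open>-n\<close>; for large \<open>n\<close> it toggles everything else on its way there, so its length is
  \<open>2 n + (n + height x)\<close> and the sequence converges to \<open>height\<close>. Mirroring it gives \<open>-height\<close>. Both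
  limits are unbounded below, unlike \<open>horo z\<close>, and they are homomorphisms, so that the cocycle
  \<open>h (g\<inverse> x) - h (g\<inverse>)\<close> is \<open>h x\<close>.\<close>

section \<open>Word length\<close>

lemma inv_lamplighter: "inv\<^bsub>lamplighter\<^esub> (A, m) = (fshift (- m) A, - m)"
  by (rule L2.inv_equality) (auto simp: mult_lamplighter one_lamplighter intro!: fset_eqI)

definition lamp_letters :: "lamp_stand set" where
  "lamp_letters = lamp_gens \<union> (\<lambda>s. inv\<^bsub>lamplighter\<^esub> s) ` lamp_gens"

text \<open>A step right may toggle the lamp being left, a step left the lamp being reached. This
  ties lamp \<open>i\<close> to the edge \<open>{i, i + 1}\<close> in both directions and puts
  \<open>-1\<close> in the last letter.\<close>

lemma lamp_letters_eq: "lamp_letters = {({||}, 1), ({|0|}, 1), ({||}, -1), ({|-1|}, -1)}"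
proof -
  have "fsym_diff {|0|} (fshift 0 {||}) = {|0|}" "fshift (- 1) {||} = {||}"
      "fshift (- 1) {|0|} = {|-1|}"
    by (auto intro!: fset_eqI)
  then show ?thesis
    by (auto simp: lamp_letters_def lamp_gens_def gen_a_def gen_t_def mult_lamplighter
        inv_lamplighter)
qed

definition lamp_word :: "lamp_stand list \<Rightarrow> lamp_stand \<Rightarrow> bool" where
  "lamp_word ws g \<longleftrightarrow>
    set ws \<subseteq> lamp_letters \<and> foldr (mult lamplighter) ws \<one>\<^bsub>lamplighter\<^esub> = g"

definition lamp_length :: "lamp_stand \<Rightarrow> nat" where
  "lamp_length = word_length lamplighter lamp_gens"

lemma lamp_length_altdef: "lamp_length g = (LEAST n. \<exists>ws. lamp_word ws g \<and> length ws = n)"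
  by (simp add: lamp_length_def word_length_def lamp_word_def lamp_letters_def conj_ac)

lemma lamp_dist_eq_length:
  "lamp_dist g h = lamp_length (inv\<^bsub>lamplighter\<^esub> g \<otimes>\<^bsub>lamplighter\<^esub> h)"
  by (simp add: lamp_dist_def lamp_length_def)

lemma lamp_length_le: "lamp_word ws g \<Longrightarrow> lamp_length g \<le> length ws"
  unfolding lamp_length_altdef by (rule Least_le) blast

text \<open>The letters generate the group, so the minimum is over a nonempty set and is attained;
  bounds valid for all words thus pass to \<open>lamp_length\<close>.\<close>

lemma ex_lamp_word: "\<exists>ws. lamp_word ws g \<and> length ws = lamp_length g"
proof -
  have "\<exists>n ws. lamp_word ws g \<and> length ws = n"
    using lamplighter_words[of g] by (simp add: lamp_word_def lamp_letters_def)
  then show ?thesis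
    unfolding lamp_length_altdef by (rule LeastI_ex)
qed

lemma lamp_word_Cons:
  "lamp_word ws g \<Longrightarrow> s \<in> lamp_letters \<Longrightarrow> lamp_word (s # ws) (s \<otimes>\<^bsub>lamplighter\<^esub> g)"
  by (auto simp: lamp_word_def)

lemma lamp_length_mult_letter:
  assumes "s \<in> lamp_letters"
  shows "lamp_length (s \<otimes>\<^bsub>lamplighter\<^esub> g) \<le> Suc (lamp_length g)"
  using ex_lamp_word[of g] lamp_length_le[OF lamp_word_Cons[OF _ assms]] by fastforce

lemma lamp_length_one: "lamp_length \<one>\<^bsub>lamplighter\<^esub> = 0"
  using lamp_length_le[of "[]"] by (simp add: lamp_word_def)

text \<open>Subadditivity lets a walk be assembled from two legs: the letters of a word for
  \<open>g\<close> are prepended to \<open>h\<close> one at a time.\<close>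

lemma lamp_length_mult:
  "lamp_length (g \<otimes>\<^bsub>lamplighter\<^esub> h) \<le> lamp_length g + lamp_length h"
proof -
  have "lamp_length (g \<otimes>\<^bsub>lamplighter\<^esub> h) \<le> length ws + lamp_length h" if "lamp_word ws g" for ws
    using that
  proof (induction ws arbitrary: g)
    case Nil
    then have "g = \<one>\<^bsub>lamplighter\<^esub>" by (simp add: lamp_word_def)
    then show ?case by simp
  next
    case (Cons s ws)
    define g' where "g' = foldr (mult lamplighter) ws \<one>\<^bsub>lamplighter\<^esub>"
    have "lamp_word ws g'" "s \<in> lamp_letters" "g = s \<otimes>\<^bsub>lamplighter\<^esub> g'"
      using Cons.prems by (auto simp: lamp_word_def g'_def)
    then show ?case
      using Cons.IH[of g'] lamp_length_mult_letter[of s "g' \<otimes>\<^bsub>lamplighter\<^esub> h"]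
      by (simp add: L2.m_assoc)
  qed
  then show ?thesis
    using ex_lamp_word[of g] by metis
qed

section \<open>Walks\<close>

text \<open>The two terms bound the length of a walk by its visits to the two ends of the edge \<open>{k, k + 1}\<close>.\<close>

lemma lamp_word_length_ge:
  assumes "lamp_word ws (C, m)"
  shows "\<bar>m\<bar> \<le> int (length ws) \<and>
    (\<forall>k. k |\<in>| C \<longrightarrow> \<bar>k\<bar> + \<bar>k - m\<bar> \<le> int (length ws) \<and>
                    \<bar>k + 1\<bar> + \<bar>k + 1 - m\<bar> \<le> int (length ws))"
  using assms
proof (induction ws arbitrary: C m)
  case Nil
  then show ?case by (simp add: lamp_word_def one_lamplighter)
next
  case (Cons s ws)
  obtain C' m' where C': "(C', m') = foldr (mult lamplighter) ws \<one>\<^bsub>lamplighter\<^esub>"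
    by (metis surj_pair)
  obtain B e where s: "s = (B, e)" by (cases s)
  have s_letter: "(B, e) \<in> lamp_letters"
    and Cm: "(C, m) = (B, e) \<otimes>\<^bsub>lamplighter\<^esub> (C', m')"
    and ws: "lamp_word ws (C', m')"
    using Cons.prems by (auto simp: lamp_word_def s C')
  have IH: "\<bar>m'\<bar> \<le> int (length ws)"
      "\<And>k. k |\<in>| C' \<Longrightarrow> \<bar>k\<bar> + \<bar>k - m'\<bar> \<le> int (length ws) \<and>
        \<bar>k + 1\<bar> + \<bar>k + 1 - m'\<bar> \<le> int (length ws)"
    using Cons.IH[OF ws] by auto
  \<comment> \<open>After the first letter the rest of the walk starts at \<open>e\<close>, so its
    lamps and its end appear shifted by \<open>e\<close>.\<close>
  have m: "m = e + m'" and C: "k |\<in>| C \<longleftrightarrow> (k |\<in>| B) \<noteq> (k - e |\<in>| C')" for k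
    using Cm by (auto simp: mult_lamplighter)
  have e: "\<bar>e\<bar> = 1" and B: "k |\<in>| B \<Longrightarrow> k = 0 \<and> e = 1 \<or> k = -1 \<and> e = -1" for k
    using s_letter by (auto simp: lamp_letters_eq)
  show ?case
  proof (intro conjI allI impI)
    show "\<bar>m\<bar> \<le> int (length (s # ws))"
      using IH(1) m e by simp
    fix k assume "k |\<in>| C"
    then consider "k |\<in>| B" | "k - e |\<in>| C'" using C by blast
    then have "\<bar>k\<bar> + \<bar>k - m\<bar> \<le> int (length (s # ws)) \<and>
        \<bar>k + 1\<bar> + \<bar>k + 1 - m\<bar> \<le> int (length (s # ws))"
    proof cases
      \<comment> \<open>The edge of \<open>k\<close> joins \<open>0\<close> and \<open>e\<close>, so
        both sums are at most \<open>\<bar>m'\<bar> + 1\<close>. This is why the induction also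
        carries the bound on \<open>\<bar>m\<bar>\<close>.\<close>
      case 1
      then show ?thesis using B IH(1) m by fastforce
    next
      case 2
      then show ?thesis using IH(2)[OF 2] m e by auto
    qed
    then show "\<bar>k\<bar> + \<bar>k - m\<bar> \<le> int (length (s # ws))"
        "\<bar>k + 1\<bar> + \<bar>k + 1 - m\<bar> \<le> int (length (s # ws))"
      by blast+
  qed
qed

lemma lamp_length_ge:
  assumes "k |\<in>| C"
  shows "\<bar>k\<bar> + \<bar>k - m\<bar> \<le> int (lamp_length (C, m))"
    and "\<bar>k + 1\<bar> + \<bar>k + 1 - m\<bar> \<le> int (lamp_length (C, m))"
  using ex_lamp_word[of "(C, m)"] lamp_word_length_ge[of _ C m] assms by metis+

text \<open>One pass to the right suffices, since each lamp from \<open>0\<close> to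
  \<open>n - 1\<close> can be toggled on leaving it.\<close>

lemma lamp_length_right_le:
  assumes "\<And>k. k |\<in>| C \<Longrightarrow> 0 \<le> k \<and> k < int n"
  shows "lamp_length (C, int n) \<le> n"
  using assms
proof (induction n arbitrary: C)
  case 0
  then have "C = {||}" by (force intro!: fset_eqI)
  then show ?case using lamp_length_one by (simp add: one_lamplighter)
next
  case (Suc n)
  \<comment> \<open>\<open>B\<close> is what the first letter toggles; \<open>C'\<close> is the
    remainder as seen from position \<open>1\<close>.\<close>
  define B where "B = C |\<inter>| {|0|}"
  define C' where "C' = fshift (- 1) (C |-| {|0|})"
  have "B = {||} \<or> B = {|0|}"
    by (auto simp: B_def)
  then have "(B, 1) \<in> lamp_letters"
    by (auto simp: lamp_letters_eq)
  moreover have "lamp_length (C', int n) \<le> n"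
    using Suc.prems by (intro Suc.IH) (force simp: C'_def)
  moreover have "(C, int (Suc n)) = (B, 1) \<otimes>\<^bsub>lamplighter\<^esub> (C', int n)"
    by (auto simp: mult_lamplighter B_def C'_def intro!: fset_eqI)
  ultimately show ?case
    using lamp_length_mult_letter[of "(B, 1)" "(C', int n)"] by simp
qed

text \<open>Leftward steps toggle on arrival, so a pass to \<open>-n\<close> serves lamp
  \<open>-n\<close> but not lamp \<open>0\<close>.\<close>

lemma lamp_length_left_le:
  assumes "\<And>k. k |\<in>| C \<Longrightarrow> - int n \<le> k \<and> k < 0"
  shows "lamp_length (C, - int n) \<le> n"
  using assms
proof (induction n arbitrary: C)
  case 0
  then have "C = {||}" by (force intro!: fset_eqI)
  then show ?case using lamp_length_one by (simp add: one_lamplighter)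
next
  case (Suc n)
  define B where "B = C |\<inter>| {|-1|}"
  define C' where "C' = fshift 1 (C |-| {|-1|})"
  have "B = {||} \<or> B = {|-1|}"
    by (auto simp: B_def)
  then have "(B, -1) \<in> lamp_letters"
    by (auto simp: lamp_letters_eq)
  moreover have "lamp_length (C', - int n) \<le> n"
    using Suc.prems by (intro Suc.IH) (force simp: C'_def)
  moreover have "(C, - int (Suc n)) = (B, -1) \<otimes>\<^bsub>lamplighter\<^esub> (C', - int n)"
    by (auto simp: mult_lamplighter B_def C'_def intro!: fset_eqI)
  ultimately show ?case
    using lamp_length_mult_letter[of "(B, -1)" "(C', - int n)"] by simp
qed

text \<open>An optimal walk goes to \<open>-n\<close>, serving all lamps on the way, and then
  straight to \<open>m\<close>; the lit lamp \<open>-n\<close> forces the visit to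
  \<open>-n\<close>.\<close>

lemma lamp_length_left_turn:
  assumes "\<And>k. k |\<in>| C \<Longrightarrow> - int n \<le> k \<and> k < 0" and "- int n |\<in>| C" and "- int n \<le> m"
  shows "int (lamp_length (C, m)) = 2 * int n + m"
proof -
  have "(C, m) = (C, - int n) \<otimes>\<^bsub>lamplighter\<^esub> ({||}, int (nat (m + int n)))"
    using assms(3) by (auto simp: mult_lamplighter intro!: fset_eqI)
  then have "lamp_length (C, m) \<le> n + nat (m + int n)"
    using lamp_length_mult[of "(C, - int n)" "({||}, int (nat (m + int n)))"]
      lamp_length_left_le[OF assms(1)] lamp_length_right_le[of "{||}" "nat (m + int n)"]
    by fastforce
  then show ?thesis
    using lamp_length_ge(1)[OF assms(2), of m] assms(3) by linarith
qed

text \<open>Lamp \<open>n - 1\<close> is the left end of its edge, so the turning point is the right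
  end \<open>n\<close>; hence the second lower bound instead of the first.\<close>

lemma lamp_length_right_turn:
  assumes "\<And>k. k |\<in>| C \<Longrightarrow> 0 \<le> k \<and> k < int n" and "int n - 1 |\<in>| C" and "m \<le> int n"
  shows "int (lamp_length (C, m)) = 2 * int n - m"
proof -
  have "(C, m) = (C, int n) \<otimes>\<^bsub>lamplighter\<^esub> ({||}, - int (nat (int n - m)))"
    using assms(3) by (auto simp: mult_lamplighter intro!: fset_eqI)
  then have "lamp_length (C, m) \<le> n + nat (int n - m)"
    using lamp_length_mult[of "(C, int n)" "({||}, - int (nat (int n - m)))"]
      lamp_length_right_le[OF assms(1)] lamp_length_left_le[of "{||}" "nat (int n - m)"]
    by fastforce
  then show ?thesis
    using lamp_length_ge(2)[OF assms(2), of m] assms(3) by linarith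
qed

section \<open>The height as a horofunction\<close>

lemma fset_int_bounded: "\<exists>N. \<forall>k. k |\<in>| A \<longrightarrow> \<bar>k\<bar> < int N"
proof (induction A)
  case empty
  then show ?case by simp
next
  case (insert x A)
  then obtain N where N: "\<And>k. k |\<in>| A \<Longrightarrow> \<bar>k\<bar> < int N" by blast
  have "\<bar>k\<bar> < int (max N (Suc (nat \<bar>x\<bar>)))" if "k |\<in>| finsert x A" for k
    using that N[of k] by auto
  then show ?case by blast
qed

lemma lamp_dist_left:
  assumes "\<And>k. k |\<in>| A \<Longrightarrow> \<bar>k\<bar> < int n" and "\<bar>m\<bar> < int n"
  shows "real (lamp_dist ({|- int n|}, int n) (A, m)) = 3 * real n + real_of_int m"
proof -
  \<comment> \<open>Seen from the start of the walk, the marker lamp is at \<open>-2 n\<close> and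
    the lamps of \<open>A\<close> lie strictly between \<open>-2 n\<close> and \<open>0\<close>, so
    they cannot cancel it.\<close>
  let ?C = "fsym_diff (fshift (- int n) {|- int n|}) (fshift (- int n) A)"
  have "int (lamp_length (?C, - int n + m)) = 2 * int (2 * n) + (- int n + m)"
  proof (rule lamp_length_left_turn)
    show "- int (2 * n) |\<in>| ?C"
      using assms(1)[of "- int n"] by auto
    show "- int (2 * n) \<le> k \<and> k < 0" if "k |\<in>| ?C" for k
      using that assms(1)[of "k + int n"] assms(2) by auto
    show "- int (2 * n) \<le> - int n + m"
      using assms(2) by simp
  qed
  then have "int (lamp_dist ({|- int n|}, int n) (A, m)) = 3 * int n + m"
    by (simp add: lamp_dist_eq_length inv_lamplighter mult_lamplighter)
  then have "real_of_int (int (lamp_dist ({|- int n|}, int n) (A, m))) = real_of_int (3 * int n + m)"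
    by (simp only:)
  then show ?thesis by simp
qed

lemma lamp_dist_right:
  assumes "\<And>k. k |\<in>| A \<Longrightarrow> \<bar>k\<bar> < int n" and "\<bar>m\<bar> < int n"
  shows "real (lamp_dist ({|int n|}, - int n) (A, m)) = 3 * real n + 2 - real_of_int m"
proof -
  let ?C = "fsym_diff (fshift (int n) {|int n|}) (fshift (int n) A)"
  \<comment> \<open>The marker is now lamp \<open>2 n\<close>, and crossing its edge means reaching
    \<open>2 n + 1\<close>. The resulting extra \<open>2\<close> does not depend on the target and
    cancels in \<open>horo\<close>.\<close>
  have "int (lamp_length (?C, int n + m)) = 2 * int (2 * n + 1) - (int n + m)"
  proof (rule lamp_length_right_turn)
    show "int (2 * n + 1) - 1 |\<in>| ?C"
      using assms(1)[of "int n"] by auto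
    show "0 \<le> k \<and> k < int (2 * n + 1)" if "k |\<in>| ?C" for k
      using that assms(1)[of "k - int n"] assms(2) by auto
    show "int n + m \<le> int (2 * n + 1)"
      using assms(2) by simp
  qed
  then have "int (lamp_dist ({|int n|}, - int n) (A, m)) = 3 * int n + 2 - m"
    by (simp add: lamp_dist_eq_length inv_lamplighter mult_lamplighter)
  then have "real_of_int (int (lamp_dist ({|int n|}, - int n) (A, m))) = real_of_int (3 * int n + 2 - m)"
    by (simp only:)
  then show ?thesis by simp
qed

text \<open>Finiteness of the set of lit lamps enters here: every fixed lamp stand eventually
  satisfies the hypotheses of the two distance formulas.\<close>

lemma eventually_inside:
  "\<forall>\<^sub>F n in sequentially. (\<forall>k. k |\<in>| A \<longrightarrow> \<bar>k\<bar> < int n) \<and> \<bar>m\<bar> < int n"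
proof -
  obtain N where N: "\<And>k. k |\<in>| finsert m A \<Longrightarrow> \<bar>k\<bar> < int N"
    using fset_int_bounded by meson
  show ?thesis
    using eventually_ge_at_top[of N] by eventually_elim (use N in force)
qed

lemma has_horolim_height:
  "has_horolim (\<lambda>n. ({|- int n|}, int n)) (\<lambda>x. real_of_int (height x))"
  unfolding has_horolim_iff
proof
  fix x :: lamp_stand
  obtain A m where x: "x = (A, m)" by (cases x)
  \<comment> \<open>Both distances contain \<open>3 n\<close>, so their difference is eventually
    constant.\<close>
  have "\<forall>\<^sub>F n in sequentially. horo ({|- int n|}, int n) x = real_of_int (height x)"
    using eventually_inside[of A m]
  proof eventually_elim
    case (elim n)
    have "real (lamp_dist ({|- int n|}, int n) x) = 3 * real n + real_of_int m"
        "real (lamp_dist ({|- int n|}, int n) \<one>\<^bsub>lamplighter\<^esub>) = 3 * real n"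
      using elim lamp_dist_left[of A n m] lamp_dist_left[of "{||}" n 0]
      by (auto simp: x one_lamplighter)
    then show ?case
      by (simp add: horo_def height_def x)
  qed
  then show "(\<lambda>n. horo ({|- int n|}, int n) x) \<longlonglongrightarrow> real_of_int (height x)"
    by (rule tendsto_eventually)
qed

lemma has_horolim_uminus_height:
  "has_horolim (\<lambda>n. ({|int n|}, - int n)) (\<lambda>x. - real_of_int (height x))"
  unfolding has_horolim_iff
proof
  fix x :: lamp_stand
  obtain A m where x: "x = (A, m)" by (cases x)
  have "\<forall>\<^sub>F n in sequentially. horo ({|int n|}, - int n) x = - real_of_int (height x)"
    using eventually_inside[of A m]
  proof eventually_elim
    case (elim n)
    have "real (lamp_dist ({|int n|}, - int n) x) = 3 * real n + 2 - real_of_int m"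
        "real (lamp_dist ({|int n|}, - int n) \<one>\<^bsub>lamplighter\<^esub>) = 3 * real n + 2"
      using elim lamp_dist_right[of A n m] lamp_dist_right[of "{||}" n 0]
      by (auto simp: x one_lamplighter)
    then show ?case
      by (simp add: horo_def height_def x)
  qed
  then show "(\<lambda>n. horo ({|int n|}, - int n) x) \<longlonglongrightarrow> - real_of_int (height x)"
    by (rule tendsto_eventually)
qed

section \<open>Boundary points and fixed points\<close>

text \<open>Convergence in the product topology is pointwise convergence, which is what
  \<open>has_horolim\<close> provides.\<close>

lemma has_horolim_closure:
  assumes "has_horolim y h"
  shows "h \<in> horo_closure"
proof -
  have "limitin (product_topology (\<lambda>_. euclidean) UNIV) (\<lambda>n. horo (y n)) h sequentially"
    using assms by (simp add: limitin_componentwise has_horolim_iff)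
  then have "(\<lambda>n. horo (y n)) \<longlonglongrightarrow> h"
    by (simp add: euclidean_product_topology)
  then show ?thesis
    unfolding horo_closure_def closure_sequential
    by (intro exI[of _ "\<lambda>n. horo (y n)"] conjI allI rangeI)
qed

lemma horo_ge: "horo z x \<ge> - real (lamp_dist z \<one>\<^bsub>lamplighter\<^esub>)"
  by (simp add: horo_def)

lemma unbounded_horolim_boundary:
  assumes "has_horolim y h" and "\<And>b. \<exists>x. h x < b"
  shows "h \<in> horo_boundary"
proof -
  have "h \<noteq> horo z" for z
    using assms(2) horo_ge[of z] by (metis not_less)
  then show ?thesis
    using has_horolim_closure[OF assms(1)] by (auto simp: horo_boundary_def)
qed

lemma horo_act_hom:
  assumes "has_horolim y h" and "\<And>g x. h (g \<otimes>\<^bsub>lamplighter\<^esub> x) = h g + h x"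
  shows "horo_act g h = h"
  using horo_act_eqI[OF assms(1) has_horolim_translate[OF assms(1)], of g] by (simp add: assms(2))

lemma height_mult: "height (g \<otimes>\<^bsub>lamplighter\<^esub> h) = height g + height h"
  by (cases g; cases h) (simp add: height_def mult_lamplighter)

theorem corollary7p3:
  shows "(\<lambda>x. real_of_int (height x)) \<in> horo_boundary \<and>
    (\<lambda>x. - real_of_int (height x)) \<in> horo_boundary \<and>
    (\<forall>g \<in> carrier lamplighter.
       horo_act g (\<lambda>x. real_of_int (height x)) = (\<lambda>x. real_of_int (height x)) \<and>
       horo_act g (\<lambda>x. - real_of_int (height x)) = (\<lambda>x. - real_of_int (height x)))"
proof (intro conjI ballI)
  show "(\<lambda>x. real_of_int (height x)) \<in> horo_boundary"
  proof (rule unbounded_horolim_boundary[OF has_horolim_height])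
    fix b :: real
    have "real_of_int (height ({||}, \<lfloor>b\<rfloor> - 1)) < b"
      by (simp add: height_def) linarith
    then show "\<exists>x. real_of_int (height x) < b" ..
  qed
  show "(\<lambda>x. - real_of_int (height x)) \<in> horo_boundary"
  proof (rule unbounded_horolim_boundary[OF has_horolim_uminus_height])
    fix b :: real
    have "- real_of_int (height ({||}, 1 - \<lfloor>b\<rfloor>)) < b"
      by (simp add: height_def) linarith
    then show "\<exists>x. - real_of_int (height x) < b" ..
  qed
  fix g
  show "horo_act g (\<lambda>x. real_of_int (height x)) = (\<lambda>x. real_of_int (height x))"
    by (rule horo_act_hom[OF has_horolim_height]) (simp add: height_mult)
  show "horo_act g (\<lambda>x. - real_of_int (height x)) = (\<lambda>x. - real_of_int (height x))"
    by (rule horo_act_hom[OF has_horolim_uminus_height]) (simp add: height_mult)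
qed

end
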